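(* A $\Psi$-space does not have a first-countable countably compact extension; that is, if $X$ is a $\Psi$-space, then there is no first countable, countably compact Hausdorff space $Y$ containing $X$ as a dense subspace.
   Context: All topological spaces are assumed to be Hausdorff. A space is countably compact if every countably infinite subset has an accumulation point. A $\Psi$-space is a space $X$ with underlying set $\omega\cup\{x_A:A\in\mathcal A\}$, where $\mathcal A$ is an infinite maximal almost disjoint family of infinite subsets of $\omega$ and the points $x_A$ are pairwise distinct and not in $\omega$; the points of $\omega$ are isolated, and the sets $\{x_A\}\cup (A\setminus F)$, $F\subset\omega$ finite, form a neighbourhood base at $x_A$ (so $A$ converges to $x_A$). *)

theory Defs
  imports "HOL-Analysis.Analysis"
begin

definition almost_disjoint_family :: "nat set set \<Rightarrow> bool" where
  "almost_disjoint_family \<A> \<longleftrightarrow>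
     (\<forall>A\<in>\<A>. infinite A) \<and> pairwise (\<lambda>A B. finite (A \<inter> B)) \<A>"

definition maximal_almost_disjoint_family :: "nat set set \<Rightarrow> bool" where
  "maximal_almost_disjoint_family \<A> \<longleftrightarrow>
     almost_disjoint_family \<A> \<and>
     (\<forall>\<B>. almost_disjoint_family \<B> \<and> \<A> \<subseteq> \<B> \<longrightarrow> \<B> = \<A>)"

(* Members of a neighbourhood base need not be open, but they must be neighbourhoods;
   the library's neighbourhood_base_at does not demand the latter. *)
definition nbhd_base_at_point :: "'a topology \<Rightarrow> 'a \<Rightarrow> 'a set set \<Rightarrow> bool" where
  "nbhd_base_at_point X p \<N> \<longleftrightarrow>
     (\<forall>N\<in>\<N>. N \<subseteq> topspace X \<and> (\<exists>U. openin X U \<and> p \<in> U \<and> U \<subseteq> N)) \<and>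
     (\<forall>U. openin X U \<and> p \<in> U \<longrightarrow> (\<exists>N\<in>\<N>. N \<subseteq> U))"

(* The map e places a copy of omega inside the point type. *)
definition Psi_space :: "'a topology \<Rightarrow> bool" where
  "Psi_space X \<longleftrightarrow>
     (\<exists>(\<A> :: nat set set) (e :: nat \<Rightarrow> 'a) (x :: nat set \<Rightarrow> 'a).
        infinite \<A> \<and> maximal_almost_disjoint_family \<A> \<and>
        inj e \<and> inj_on x \<A> \<and> range e \<inter> x ` \<A> = {} \<and>
        topspace X = range e \<union> x ` \<A> \<and>
        (\<forall>n. openin X {e n}) \<and>
        (\<forall>A\<in>\<A>. nbhd_base_at_point X (x A) {{x A} \<union> e ` (A - F) | F. finite F}))"

(* Not the library's countably_compact, which is the covering property for sets in a
   type-class topology. *)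
definition countably_compact_space :: "'a topology \<Rightarrow> bool" where
  "countably_compact_space Y \<longleftrightarrow>
     (\<forall>S. S \<subseteq> topspace Y \<and> countable S \<and> infinite S \<longrightarrow> Y derived_set_of S \<noteq> {})"

(* X is regarded as a subspace of Y along f; literal containment is the case where f is
   the identity. *)
definition dense_embedding :: "'a topology \<Rightarrow> 'b topology \<Rightarrow> ('a \<Rightarrow> 'b) \<Rightarrow> bool" where
  "dense_embedding X Y f \<longleftrightarrow>
     embedding_map X Y f \<and> Y closure_of (f ` topspace X) = topspace Y"

end

theory Submission
  imports Defs
begin

text \<open>
  Let \<open>Y\<close> be a first countable, countably compact Hausdorff space with the \<open>\<Psi>\<close>-space \<open>X\<close>
  as a dense subspace. The points \<open>x A\<close> form an infinite set without accumulation point in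
  \<open>X\<close>, so countable compactness yields an accumulation point \<open>p\<close> of them in \<open>Y\<close> that lies
  outside \<open>X\<close>. The natural numbers are dense in \<open>X\<close>, hence in \<open>Y\<close>, and first countability turns this
  into an infinite set \<open>B\<close> of natural numbers converging to \<open>p\<close>
  (\<open>convergent_infinite_set_of_dense_range\<close>). By maximality some member \<open>A\<close> of the almost
  disjoint family meets \<open>B\<close> in an infinite set
  (\<open>maximal_almost_disjoint_family_meets_infinite\<close>). That set converges both to \<open>p\<close> and to
  \<open>x A\<close>, which are distinct because \<open>x A\<close> lies in \<open>X\<close>; this is impossible in a Hausdorff space.
\<close>

text \<open>Otherwise \<open>B\<close> could be added to the family.\<close>

lemma maximal_almost_disjoint_family_meets_infinite:
  assumes mad: "maximal_almost_disjoint_family \<A>" and "infinite B"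
  shows "\<exists>A\<in>\<A>. infinite (A \<inter> B)"
proof (rule ccontr)
  assume "\<not> ?thesis"
  then have fin: "\<And>A. A \<in> \<A> \<Longrightarrow> finite (A \<inter> B)"
    by blast
  have "almost_disjoint_family \<A>"
    using mad by (simp add: maximal_almost_disjoint_family_def)
  then have "almost_disjoint_family (insert B \<A>)"
    using fin \<open>infinite B\<close>
    by (auto simp: almost_disjoint_family_def pairwise_insert Int_commute)
  then have "insert B \<A> = \<A>"
    using mad by (auto simp: maximal_almost_disjoint_family_def)
  then have "finite (B \<inter> B)"
    using fin by blast
  then show False
    using \<open>infinite B\<close> by simp
qed

text \<open>
  Removing finitely many points from a neighbourhood of \<open>p\<close> leaves a neighbourhood of \<open>p\<close>, so
  each neighbourhood contains \<open>g n\<close> for arbitrarily large \<open>n\<close>. Diagonalizing along a countable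
  base at \<open>p\<close> gives the set.
\<close>

lemma convergent_infinite_set_of_dense_range:
  fixes g :: "nat \<Rightarrow> 'a"
  assumes "t1_space Y" "first_countable Y"
    and dense: "Y closure_of (range g) = topspace Y"
    and p: "p \<in> topspace Y" "p \<notin> range g"
  obtains B where "infinite B"
    "\<And>U. openin Y U \<Longrightarrow> p \<in> U \<Longrightarrow> finite {n \<in> B. g n \<notin> U}"
proof -
  obtain \<B> where "countable \<B>" and op: "\<And>V. V \<in> \<B> \<Longrightarrow> openin Y V"
    and base: "\<And>U. openin Y U \<Longrightarrow> p \<in> U \<Longrightarrow> \<exists>V\<in>\<B>. p \<in> V \<and> V \<subseteq> U"
    using \<open>first_countable Y\<close> p(1) unfolding first_countable_def by metis
  define \<C> where "\<C> = {V \<in> \<B>. p \<in> V}"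
  have "countable \<C>"
    using \<open>countable \<B>\<close> by (simp add: \<C>_def)
  have "\<C> \<noteq> {}"
    using base[of "topspace Y"] p(1) by (auto simp: \<C>_def)
  define V where "V = from_nat_into \<C>"
  have V: "openin Y (V i)" "p \<in> V i" for i
    using from_nat_into[OF \<open>\<C> \<noteq> {}\<close>, of i] op by (auto simp: V_def \<C>_def)
  have "\<exists>n\<ge>k. \<forall>i\<le>k. g n \<in> V i" for k
  proof -
    \<comment> \<open>The intersection with \<open>topspace Y\<close> matters: \<open>g\<close> may take values outside \<open>Y\<close>.\<close>
    let ?W = "(\<Inter>i\<le>k. V i) - g ` {..<k} \<inter> topspace Y"
    have "closedin Y (g ` {..<k} \<inter> topspace Y)"
      using \<open>t1_space Y\<close> by (auto intro: closedin_t1_singleton simp: t1_space_closedin_finite)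
    then have "openin Y ?W"
      using V(1) by auto
    moreover have "p \<in> ?W"
      using V(2) p(2) by auto
    moreover have "p \<in> Y closure_of (range g)"
      using dense p(1) by simp
    ultimately obtain y where "y \<in> range g" "y \<in> ?W"
      unfolding in_closure_of by meson
    then obtain n where n: "g n \<in> ?W"
      by blast
    have "g n \<in> topspace Y"
      using n openin_subset[OF \<open>openin Y ?W\<close>] by blast
    with n have "g n \<notin> g ` {..<k}"
      by blast
    then have "n \<ge> k"
      by (metis imageI lessThan_iff not_le)
    then show ?thesis
      using n by auto
  qed
  then obtain n where n: "\<And>k. n k \<ge> k" "\<And>k i. i \<le> k \<Longrightarrow> g (n k) \<in> V i"
    by metis
  show thesis
  proof
    \<comment> \<open>The values \<open>n k\<close> may repeat, but \<open>n k \<ge> k\<close> makes them unbounded.\<close>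
    show "infinite (range n)"
      using n(1) by (metis finite_nat_set_iff_bounded not_le rangeI)
  next
    fix U assume U: "openin Y U" "p \<in> U"
    obtain W where "W \<in> \<C>" "W \<subseteq> U"
      using base[OF U] by (auto simp: \<C>_def)
    then obtain i where "V i \<subseteq> U"
      using from_nat_into_surj[OF \<open>countable \<C>\<close>] V_def by metis
    then have "k < i" if "g (n k) \<notin> U" for k
      using n(2) that by (meson not_le subsetD)
    then have "{m \<in> range n. g m \<notin> U} \<subseteq> n ` {..<i}"
      by blast
    then show "finite {m \<in> range n. g m \<notin> U}"
      by (rule finite_subset) simp
  qed
qed

lemma nbhd_base_at_point_Psi:
  assumes "nbhd_base_at_point X p {{p} \<union> e ` (A - F) | F. finite F}" "openin X U" "p \<in> U"
  obtains F where "finite F" "e ` (A - F) \<subseteq> U"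
proof -
  obtain N where "N \<in> {{p} \<union> e ` (A - F) | F. finite F}" "N \<subseteq> U"
    using assms unfolding nbhd_base_at_point_def by meson
  then show thesis
    using that by blast
qed

theorem proposition1p3:
  fixes X :: "'a topology"
  assumes "Psi_space X"
  shows "\<not> (\<exists>(Y :: 'b topology) (f :: 'a \<Rightarrow> 'b).
            Hausdorff_space Y \<and> first_countable Y \<and> countably_compact_space Y \<and>
            dense_embedding X Y f)"
proof
  assume "\<exists>(Y :: 'b topology) (f :: 'a \<Rightarrow> 'b).
            Hausdorff_space Y \<and> first_countable Y \<and> countably_compact_space Y \<and>
            dense_embedding X Y f"
  then obtain Y :: "'b topology" and f :: "'a \<Rightarrow> 'b" where
    Y: "Hausdorff_space Y" "first_countable Y" "countably_compact_space Y"
    and emb: "embedding_map X Y f"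
    and dense: "Y closure_of (f ` topspace X) = topspace Y"
    unfolding dense_embedding_def by blast
  obtain \<A> and e :: "nat \<Rightarrow> 'a" and x where
    \<A>: "infinite \<A>" "maximal_almost_disjoint_family \<A>"
    and inj_x: "inj_on x \<A>"
    and disj: "range e \<inter> x ` \<A> = {}"
    and top: "topspace X = range e \<union> x ` \<A>"
    and iso: "\<And>n. openin X {e n}"
    and base: "\<And>A. A \<in> \<A> \<Longrightarrow>
      nbhd_base_at_point X (x A) {{x A} \<union> e ` (A - F) | F. finite F}"
    using assms unfolding Psi_space_def by blast
  have inf: "infinite A" if "A \<in> \<A>" for A
    using \<A>(2) that
    by (simp add: maximal_almost_disjoint_family_def almost_disjoint_family_def)
  have cont: "continuous_map X Y f"
    using homeomorphic_imp_continuous_map[OF emb[unfolded embedding_map_def]]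
    by (simp add: continuous_map_in_subtopology)
  have f_top: "f ` topspace X \<subseteq> topspace Y"
    using cont by (rule continuous_map_image_subset_topspace)
  have inj_f: "inj_on f (topspace X)"
    using emb homeomorphic_imp_injective_map unfolding embedding_map_def by blast

  have "y \<in> X closure_of (range e)" if y: "y \<in> topspace X" for y
  proof (cases "y \<in> range e")
    case True
    then show ?thesis
      using closure_of_subset[of "range e" X] top by auto
  next
    case False
    then obtain A where A: "A \<in> \<A>" "y = x A"
      using y unfolding top by blast
    have "\<exists>z\<in>range e. z \<in> U" if U: "y \<in> U" "openin X U" for U
    proof -
      obtain F where "finite F" "e ` (A - F) \<subseteq> U"
        by (rule nbhd_base_at_point_Psi[OF base[OF A(1)] U(2) U(1)[unfolded A(2)]])
      moreover have "A - F \<noteq> {}"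
        using Diff_infinite_finite[OF \<open>finite F\<close> inf[OF A(1)]] by force
      ultimately show ?thesis
        by blast
    qed
    then show ?thesis
      using y by (auto simp: in_closure_of)
  qed
  then have "f ` topspace X \<subseteq> Y closure_of (f ` range e)"
    using continuous_map_image_closure_subset[OF cont, of "range e"] by blast
  then have "Y closure_of (f ` topspace X) \<subseteq> Y closure_of (f ` range e)"
    by (simp add: closure_of_minimal)
  then have dense_e: "Y closure_of (range (f \<circ> e)) = topspace Y"
    using dense closure_of_subset_topspace[of Y "range (f \<circ> e)"] by (simp add: image_comp)

  \<comment> \<open>Basic neighbourhoods in \<open>X\<close> contain at most one of the points \<open>x A\<close>.\<close>
  have no_acc: "X derived_set_of (x ` \<A>) = {}"
  proof (rule equals0I)
    fix y assume y: "y \<in> X derived_set_of (x ` \<A>)"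
    then have acc: "\<exists>z\<in>x ` \<A>. z \<noteq> y \<and> z \<in> U" if "openin X U" "y \<in> U" for U
      using that by (auto simp: in_derived_set_of)
    have "y \<in> range e \<union> x ` \<A>"
      using y derived_set_of_subset_topspace[of X "x ` \<A>"] top by auto
    then consider n where "y = e n" | A where "A \<in> \<A>" "y = x A"
      by blast
    then show False
    proof cases
      case 1
      then show False
        using acc[OF iso[of n]] by simp
    next
      case 2
      have "{x A} \<union> e ` (A - {}) \<in> {{x A} \<union> e ` (A - F) | F. finite F}"
        by blast
      then obtain U where "openin X U" "x A \<in> U" "U \<subseteq> {x A} \<union> e ` (A - {})"
        using base[OF 2(1)] unfolding nbhd_base_at_point_def by meson
      then show False
        using acc[of U] 2 disj by blast
    qed
  qed

  obtain \<C> where \<C>: "\<C> \<subseteq> \<A>" "countable \<C>" "infinite \<C>"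
    using infinite_countable_subset'[OF \<A>(1)] by blast
  have x\<C>: "x ` \<C> \<subseteq> topspace X"
    using \<C>(1) top by blast
  have "infinite (f ` x ` \<C>)"
    using \<C> inj_on_subset[OF inj_x \<C>(1)] inj_on_subset[OF inj_f x\<C>]
    by (simp add: finite_image_iff)
  then have "Y derived_set_of (f ` x ` \<C>) \<noteq> {}"
    using Y(3) x\<C> f_top \<C>(2) unfolding countably_compact_space_def
    by (metis countable_image image_mono subset_trans)
  then obtain p where p: "p \<in> Y derived_set_of (f ` x ` \<C>)"
    by blast
  then have p_top: "p \<in> topspace Y"
    by (simp add: in_derived_set_of)

  \<comment> \<open>Accumulation in \<open>Y\<close> at a point of the subspace would be accumulation in \<open>X\<close>.\<close>
  have p_new: "p \<notin> f ` topspace X"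
  proof
    assume "p \<in> f ` topspace X"
    moreover have "f ` topspace X \<inter> f ` x ` \<C> = f ` x ` \<C>"
      using x\<C> by blast
    ultimately have "p \<in> subtopology Y (f ` topspace X) derived_set_of (f ` x ` \<C>)"
      using p by (simp add: derived_set_of_subtopology)
    also have "\<dots> = f ` (X derived_set_of (x ` \<C>))"
      by (rule homeomorphic_map_derived_set_of[OF emb[unfolded embedding_map_def] x\<C>])
    also have "\<dots> \<subseteq> f ` (X derived_set_of (x ` \<A>))"
      using \<C>(1) by (intro image_mono derived_set_of_mono)
    finally show False
      using no_acc by simp
  qed

  have "p \<notin> range (f \<circ> e)"
    using p_new top by auto
  then obtain B where B: "infinite B"
    and conv_p: "\<And>U. openin Y U \<Longrightarrow> p \<in> U \<Longrightarrow> finite {n \<in> B. (f \<circ> e) n \<notin> U}"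
    using convergent_infinite_set_of_dense_range
      [OF Hausdorff_imp_t1_space[OF Y(1)] Y(2) dense_e p_top] by blast
  obtain A where A: "A \<in> \<A>" "infinite (A \<inter> B)"
    using maximal_almost_disjoint_family_meets_infinite[OF \<A>(2) B] by blast
  have xA: "x A \<in> topspace X"
    using A(1) top by blast
  then have "f (x A) \<in> topspace Y" "f (x A) \<noteq> p"
    using f_top p_new by auto
  then obtain U V where UV: "openin Y U" "openin Y V" "f (x A) \<in> U" "p \<in> V" "disjnt U V"
    using Y(1) p_top unfolding Hausdorff_space_def by metis
  have "openin X {z \<in> topspace X. f z \<in> U}"
    using cont UV(1) by (rule openin_continuous_map_preimage)
  moreover have "x A \<in> {z \<in> topspace X. f z \<in> U}"
    using xA UV(3) by simp
  ultimately obtain F where F: "finite F" "e ` (A - F) \<subseteq> {z \<in> topspace X. f z \<in> U}"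
    by (rule nbhd_base_at_point_Psi[OF base[OF A(1)]])
  \<comment> \<open>A number in \<open>A \<inter> B\<close> outside both finite exceptional sets is sent into \<open>U \<inter> V\<close>.\<close>
  have "A \<inter> B \<subseteq> F \<union> {n \<in> B. (f \<circ> e) n \<notin> V}"
    using F(2) UV(5) by (auto simp: disjnt_iff)
  then have "finite (A \<inter> B)"
    by (rule finite_subset) (simp add: F(1) conv_p[OF UV(2,4), simplified])
  then show False
    using A(2) by simp
qed

end
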